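(* Let $F\in C^{0}(\mathbb{R}^n;\mathbb{R}^n)$ be a complete vector field giving rise to $\dot{x}=F(x)$, and suppose that $0\in\mathbb{R}^n$ is globally asymptotically stable (GAS) under $F$. If there is a convex $C^{\infty}$ Lyapunov function $V:\mathbb{R}^n\to\mathbb{R}_{\geq 0}$ (with respect to $F$ and $0$) asserting that $0$ is GAS, then $F$ is straight-line homotopic to $-\mathrm{id}_{\mathbb{R}^n}$ such that $0$ is GAS throughout the homotopy; that is, for every $s\in[0,1]$ the point $0$ is GAS under the vector field $x\mapsto H(s,x):=(1-s)F(x)-s\,x$.
   Context: A continuous vector field $F$ on $\mathbb{R}^n$ is complete if it induces a continuous global flow $\varphi:\mathbb{R}\times\mathbb{R}^n\to\mathbb{R}^n$, with $t\mapsto\varphi^t(x_0)$ describing the solution of $\dot x=F(x)$ from $x_0$. Global asymptotic stability: for a continuous vector field $G$ on $\mathbb{R}^n$ with $G(0)=0$, the point $0$ is GAS under $G$ if (i) (Lyapunov stability) for every open neighbourhood $U_\varepsilon$ of $0$ there is an open neighbourhood $U_\delta\subseteq U_\varepsilon$ of $0$ such that every solution of $\dot x=G(x)$ starting in $U_\delta$ at time $0$ stays in $U_\varepsilon$ for all forward times; and (ii) (global attractivity) for every $x_0\in\mathbb{R}^n$, every maximal forward solution with $x(0)=x_0$ is defined for all $t\ge 0$ and satisfies $\lim_{t\to+\infty}x(t)=0$. If $G$ induces a flow $\varphi$, (ii) says $\lim_{t\to+\infty}\varphi^t(x_0)=0$ for all $x_0$. Lyapunov function: $V\in C^{\infty}(\mathbb{R}^n;\mathbb{R}_{\geq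 0})$ is a Lyapunov function with respect to $F$ and $0$ if (a) $V(0)=0$ and $V(x)>0$ for all $x\neq 0$; (b) $\langle\nabla V(x),F(x)\rangle<0$ for all $x\neq 0$; (c) $V(x)\to+\infty$ as $\|x\|\to+\infty$. The map $-\mathrm{id}_{\mathbb{R}^n}$ denotes the vector field $x\mapsto -x$. The straight-line homotopy between $f,g\in C^0(\mathbb{R}^n;\mathbb{R}^n)$ is $H(s,x)=(1-s)f(x)+s\,g(x)$, $s\in[0,1]$. *)

theory Defs
  imports "HOL-Analysis.Analysis"
begin

subsection \<open>Smooth functions and gradients\<close>

fun Ck :: "nat \<Rightarrow> ('a::euclidean_space \<Rightarrow> real) \<Rightarrow> bool" where
  "Ck 0 f \<longleftrightarrow> continuous_on UNIV f"
| "Ck (Suc k) f \<longleftrightarrow>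
     f differentiable_on UNIV \<and> (\<forall>v. Ck k (\<lambda>x. frechet_derivative f (at x) v))"

definition smooth :: "('a::euclidean_space \<Rightarrow> real) \<Rightarrow> bool" where
  "smooth f \<longleftrightarrow> (\<forall>k. Ck k f)"

definition gradient :: "('a::euclidean_space \<Rightarrow> real) \<Rightarrow> 'a \<Rightarrow> 'a" where
  "gradient f x = (THE D. GDERIV f x :> D)"

lemma GDERIV_unique:
  assumes "GDERIV f x :> D" "GDERIV f x :> E"
  shows "D = E"
proof -
  have "(\<lambda>h. h \<bullet> D) = (\<lambda>h. h \<bullet> E)"
    using assms unfolding gderiv_def by (rule has_derivative_unique)
  then have "\<And>h. h \<bullet> D = h \<bullet> E" by meson
  then show ?thesis by (metis vector_eq_ldot)
qed

lemma GDERIV_gradient: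
  fixes f :: "'a::euclidean_space \<Rightarrow> real"
  assumes "f differentiable (at x)"
  shows "GDERIV f x :> gradient f x"
proof -
  obtain f' where f': "(f has_derivative f') (at x)"
    using assms by (auto simp: differentiable_def)
  then have "linear f'" by (rule has_derivative_linear)
  then have "f' h = h \<bullet> adjoint f' 1" for h
    by (metis adjoint_works inner_real_def mult.comm_neutral)
  then have "f' = (\<lambda>h. h \<bullet> adjoint f' 1)" by (rule ext)
  then have "GDERIV f x :> adjoint f' 1"
    using f' unfolding gderiv_def by metis
  then show ?thesis
    unfolding gradient_def by (metis GDERIV_unique theI)
qed

subsection \<open>Solutions, completeness, stability\<close>

definition solution_on :: "('a::real_normed_vector \<Rightarrow> 'a) \<Rightarrow> real set \<Rightarrow> (real \<Rightarrow> 'a) \<Rightarrow> bool" where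
  "solution_on G J x \<longleftrightarrow> (\<forall>t\<in>J. (x has_vector_derivative G (x t)) (at t within J))"

text \<open>Trajectories of the flow are \<^emph>\<open>the\<close> solutions: the last conjunct says that every solution
  on an interval containing time 0 follows the flow.\<close>

definition complete_vector_field :: "('a::real_normed_vector \<Rightarrow> 'a) \<Rightarrow> bool" where
  "complete_vector_field F \<longleftrightarrow>
     (\<exists>\<phi> :: real \<Rightarrow> 'a \<Rightarrow> 'a.
        continuous_on UNIV (\<lambda>(t, x). \<phi> t x) \<and>
        (\<forall>x. \<phi> 0 x = x) \<and>
        (\<forall>s t x. \<phi> (s + t) x = \<phi> s (\<phi> t x)) \<and>
        (\<forall>x0. solution_on F UNIV (\<lambda>t. \<phi> t x0)) \<and>
        (\<forall>x0 J x. is_interval J \<and> 0 \<in> J \<and> solution_on F J x \<and> x 0 = x0 \<longrightarrow>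
           (\<forall>t\<in>J. x t = \<phi> t x0)))"

definition forward_solution :: "('a::real_normed_vector \<Rightarrow> 'a) \<Rightarrow> real set \<Rightarrow> (real \<Rightarrow> 'a) \<Rightarrow> bool" where
  "forward_solution G J x \<longleftrightarrow> is_interval J \<and> 0 \<in> J \<and> J \<subseteq> {0..} \<and> solution_on G J x"

definition maximal_forward_solution ::
    "('a::real_normed_vector \<Rightarrow> 'a) \<Rightarrow> real set \<Rightarrow> (real \<Rightarrow> 'a) \<Rightarrow> bool" where
  "maximal_forward_solution G J x \<longleftrightarrow>
     forward_solution G J x \<and>
     (\<forall>J' y. forward_solution G J' y \<and> J \<subseteq> J' \<and> (\<forall>t\<in>J. y t = x t) \<longrightarrow> J' = J)"

definition lyapunov_stable :: "('a::real_normed_vector \<Rightarrow> 'a) \<Rightarrow> bool" where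
  "lyapunov_stable G \<longleftrightarrow>
     (\<forall>U. open U \<and> 0 \<in> U \<longrightarrow>
       (\<exists>W. open W \<and> 0 \<in> W \<and> W \<subseteq> U \<and>
         (\<forall>J x. forward_solution G J x \<and> x 0 \<in> W \<longrightarrow> (\<forall>t\<in>J. x t \<in> U))))"

definition globally_attractive :: "('a::real_normed_vector \<Rightarrow> 'a) \<Rightarrow> bool" where
  "globally_attractive G \<longleftrightarrow>
     (\<forall>x0 J x. maximal_forward_solution G J x \<and> x 0 = x0 \<longrightarrow>
        J = {0..} \<and> (x \<longlongrightarrow> 0) at_top)"

definition GAS :: "('a::real_normed_vector \<Rightarrow> 'a) \<Rightarrow> bool" where
  "GAS G \<longleftrightarrow> continuous_on UNIV G \<and> G 0 = 0 \<and> lyapunov_stable G \<and> globally_attractive G"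

definition lyapunov_function ::
    "('a::euclidean_space \<Rightarrow> 'a) \<Rightarrow> ('a \<Rightarrow> real) \<Rightarrow> bool" where
  "lyapunov_function F V \<longleftrightarrow>
     smooth V \<and> (\<forall>x. V x \<ge> 0) \<and>
     V 0 = 0 \<and> (\<forall>x. x \<noteq> 0 \<longrightarrow> V x > 0) \<and>
     (\<forall>x. x \<noteq> 0 \<longrightarrow> gradient V x \<bullet> F x < 0) \<and>
     filterlim V at_top at_infinity"

definition straight_line_homotopy ::
    "('a \<Rightarrow> 'b::real_vector) \<Rightarrow> ('a \<Rightarrow> 'b) \<Rightarrow> real \<Rightarrow> 'a \<Rightarrow> 'b" where
  "straight_line_homotopy f g s x = (1 - s) *\<^sub>R f x + s *\<^sub>R g x"

end

(* Convexity gives <grad V x, x> >= V x - V 0 > 0 for x \<noteq> 0, so V decreases strictly along -x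
   and hence along every convex combination of F and -id: the same V is a Lyapunov function
   throughout the homotopy. The intermediate fields are only continuous, and a maximal forward
   solution could a priori end on a closed interval [0, b]; Peano's theorem rules this out, and
   bounded sublevel sets rule out blow-up. *)
theory Submission
  imports Defs "HOL-Complex_Analysis.Great_Picard"
begin

section \<open>Peano's existence theorem, via Tonelli's delayed approximations\<close>

text \<open>Tonelli's delayed equation x'(t) = G (x (t - h)): the delay makes the k-th iterate correct
  on [0, k h], so no fixed point theorem is needed. The integral over {0..t} vanishes for t < 0,
  which supplies the constant initial history.\<close>

fun tonelli :: "('a::euclidean_space \<Rightarrow> 'a) \<Rightarrow> 'a \<Rightarrow> real \<Rightarrow> nat \<Rightarrow> real \<Rightarrow> 'a" where
  "tonelli G x0 h 0 = (\<lambda>t. x0)"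
| "tonelli G x0 h (Suc k) = (\<lambda>t. x0 + integral {0..t} (\<lambda>s. G (tonelli G x0 h k (s - h))))"

text \<open>The Lipschitz bound is wanted on the whole line, because the delayed argument
  \<open>s - h\<close> runs below 0. There \<open>{0..t}\<close> is empty and the integral is 0,
  which accounts for the case splits at 0.\<close>

lemma norm_integral_diff_le:
  fixes f :: "real \<Rightarrow> 'a::euclidean_space"
  assumes cont: "continuous_on UNIV f" and M: "\<And>t. norm (f t) \<le> M"
  shows "norm (integral {0..s} f - integral {0..t} f) \<le> M * \<bar>s - t\<bar>"
proof -
  have c: "continuous_on A f" for A using cont continuous_on_subset by blast
  have M0: "M \<ge> 0" using M[of 0] norm_ge_zero order_trans by blast
  have *: "norm (integral {0..t} f - integral {0..s} f) \<le> M * (t - s)" if "s \<le> t" for s t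
  proof (cases "0 \<le> s")
    case True
    have "integral {0..s} f + integral {s..t} f = integral {0..t} f"
      using True that by (intro Henstock_Kurzweil_Integration.integral_combine integrable_continuous_real c)
    then have "integral {0..t} f - integral {0..s} f = integral {s..t} f"
      by (metis add_diff_cancel_left')
    then show ?thesis using integral_bound[OF that c M] by simp
  next
    case False
    then have s: "integral {0..s} f = 0" by simp
    show ?thesis
    proof (cases "0 \<le> t")
      case True
      have "norm (integral {0..t} f) \<le> M * (t - 0)" using integral_bound[OF True c M] .
      also have "\<dots> \<le> M * (t - s)" using False M0 by (intro mult_left_mono) auto
      finally show ?thesis using s by simp
    next
      case False
      then show ?thesis using s M0 that by simp
    qed
  qed
  show ?thesis
    using *[of s t] *[of t s] by (cases "s \<le> t") (auto simp: norm_minus_commute)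
qed

text \<open>The constant \<open>M\<close> depends on neither \<open>h\<close> nor \<open>k\<close>,
  which gives the equicontinuity for Arzela-Ascoli. Continuity of one iterate, itself a consequence
  of the bound, makes the next integrand continuous and so drives the induction.\<close>

lemma tonelli_lipschitz:
  assumes cont: "continuous_on UNIV G" and M: "\<And>x. norm (G x) \<le> M"
  shows "norm (tonelli G x0 h k s - tonelli G x0 h k t) \<le> M * \<bar>s - t\<bar>"
    and "continuous_on UNIV (tonelli G x0 h k)"
proof -
  have M0: "M \<ge> 0" using M[of 0] norm_ge_zero order_trans by blast
  have lip: "continuous_on UNIV f" if "\<And>s t. norm (f s - f t) \<le> M * \<bar>s - t\<bar>" for f :: "real \<Rightarrow> 'a"
    using that M0
    by (intro lipschitz_on_continuous_on[of M]) (auto simp: lipschitz_on_def dist_norm)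
  have "norm (tonelli G x0 h k s - tonelli G x0 h k t) \<le> M * \<bar>s - t\<bar>" for s t
  proof (induction k arbitrary: s t)
    case 0
    then show ?case using M0 by simp
  next
    case (Suc k)
    have "continuous_on UNIV (\<lambda>s. tonelli G x0 h k (s - h))"
      by (rule continuous_on_compose2[OF lip[OF Suc]]) (auto intro!: continuous_intros)
    then have "continuous_on UNIV (\<lambda>s. G (tonelli G x0 h k (s - h)))"
      by (rule continuous_on_compose2[OF cont]) auto
    from norm_integral_diff_le[OF this M] show ?case by simp
  qed
  then show "norm (tonelli G x0 h k s - tonelli G x0 h k t) \<le> M * \<bar>s - t\<bar>"
    "continuous_on UNIV (tonelli G x0 h k)" using lip by auto
qed

text \<open>For \<open>s\<close> up to \<open>(k + 1) * h\<close> the integrand looks back to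
  \<open>s - h\<close>, at most \<open>k * h\<close>, where the iterates already agree. In the base
  case \<open>t\<close> is at most 0 and the integral vanishes; negative times are included since
  \<open>s - h\<close> may be negative.\<close>

lemma tonelli_Suc_eq:
  assumes "h \<ge> 0" "t \<le> real k * h"
  shows "tonelli G x0 h (Suc k) t = tonelli G x0 h k t"
  using assms(2)
proof (induction k arbitrary: t)
  case 0
  then show ?case by (cases "t = 0") auto
next
  case (Suc k)
  have "integral {0..t} (\<lambda>s. G (tonelli G x0 h (Suc k) (s - h)))
      = integral {0..t} (\<lambda>s. G (tonelli G x0 h k (s - h)))"
    using Suc.prems assms(1)
    by (intro Henstock_Kurzweil_Integration.integral_cong arg_cong[of _ _ G] Suc.IH)
       (auto simp: algebra_simps)
  then show ?case by (simp only: tonelli.simps)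
qed

lemma tonelli_0: "tonelli G x0 h k 0 = x0"
  by (cases k) auto

text \<open>A subsequence of the delayed solutions converges uniformly on \<open>{0..1}\<close> by
  Arzela-Ascoli. As the delay tends to 0, the delayed integral equations turn into the integral form
  of the differential equation.\<close>

lemma peano_bounded:
  fixes G :: "'a::euclidean_space \<Rightarrow> 'a"
  assumes cont: "continuous_on UNIV G" and M: "\<And>x. norm (G x) \<le> M"
  obtains y where "y 0 = x0" "solution_on G {0..1} y"
    "\<And>t. t \<in> {0..1} \<Longrightarrow> norm (y t - x0) \<le> M * t"
proof -
  have M0: "M \<ge> 0" using M[of 0] norm_ge_zero order_trans by blast
  \<comment> \<open>Delay \<open>1 / (n + 1)\<close> and \<open>n + 1\<close> iterations: their
    product is 1, so by \<open>tonelli_Suc_eq\<close> one further iteration changes nothing on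
    \<open>{0..1}\<close>, and \<open>Y n\<close> solves the delayed equation there.\<close>
  define h where "h n = 1 / real (Suc n)" for n
  define Y where "Y n = tonelli G x0 (h n) (Suc n)" for n
  have Y_lip: "norm (Y n s - Y n t) \<le> M * \<bar>s - t\<bar>" for n s t
    unfolding Y_def by (rule tonelli_lipschitz[OF cont M])
  have Y_cont: "continuous_on UNIV (Y n)" for n
    unfolding Y_def by (rule tonelli_lipschitz[OF cont M])
  have Y_0: "Y n 0 = x0" for n by (simp add: Y_def tonelli_0 del: tonelli.simps)
  have Y_eq: "Y n t = x0 + integral {0..t} (\<lambda>s. G (Y n (s - h n)))" if "t \<in> {0..1}" for n t
  proof -
    have "tonelli G x0 (h n) (Suc (Suc n)) t = tonelli G x0 (h n) (Suc n) t"
      using that by (intro tonelli_Suc_eq) (auto simp: h_def)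
    then show ?thesis unfolding Y_def by (simp only: tonelli.simps)
  qed
  have Y_bound: "norm (Y n t - x0) \<le> M * t" if "t \<in> {0..1}" for n t
    using Y_lip[of n t 0] that by (simp add: Y_0)
  have "norm (Y n t) \<le> M + norm x0" if "t \<in> {0..1}" for n t
  proof -
    have "norm (Y n t) \<le> norm (Y n t - x0) + norm x0" by (metis diff_add_cancel norm_triangle_ineq)
    moreover have "M * t \<le> M" using that M0 by (simp add: mult_left_le)
    ultimately show ?thesis using Y_bound[OF that, of n] by linarith
  qed
  moreover have "\<exists>d>0. \<forall>n t. t \<in> {0..1} \<and> norm (s - t) < d \<longrightarrow> norm (Y n s - Y n t) < e"
    if "e > 0" for s e
  \<comment> \<open>Dividing by \<open>M + 1\<close> covers the case \<open>M = 0\<close>.\<close>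
  proof (intro exI[of _ "e / (M + 1)"] conjI allI impI)
    show "e / (M + 1) > 0" using that M0 by simp
    fix n t assume t: "t \<in> {0..1} \<and> norm (s - t) < e / (M + 1)"
    have "M * \<bar>s - t\<bar> \<le> (M + 1) * \<bar>s - t\<bar>" by (simp add: algebra_simps)
    also have "\<dots> < e" using t M0 by (simp add: field_simps)
    finally show "norm (Y n s - Y n t) < e" using Y_lip[of n s t] by simp
  qed
  ultimately obtain y k where y: "continuous_on {0..1} y" "strict_mono (k :: nat \<Rightarrow> nat)"
      "\<And>e. 0 < e \<Longrightarrow> \<exists>N. \<forall>n t. n \<ge> N \<and> t \<in> {0..1} \<longrightarrow> norm (Y (k n) t - y t) < e"
    using Arzela_Ascoli[of "{0..1}" Y "M + norm x0"] by auto metis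
  have lim: "(\<lambda>n. Y (k n) t) \<longlonglongrightarrow> y t" if "t \<in> {0..1}" for t
    using y(3) that unfolding LIMSEQ_def dist_norm by meson
  \<comment> \<open>The common Lipschitz constant bounds the effect of the delay by
    \<open>M * h (k n)\<close>, which tends to 0.\<close>
  have lim': "(\<lambda>n. Y (k n) (t - h (k n))) \<longlonglongrightarrow> y t" if "t \<in> {0..1}" for t
  proof -
    have "h \<longlonglongrightarrow> 0" unfolding h_def using LIMSEQ_inverse_real_of_nat by (simp add: inverse_eq_divide)
    then have "(\<lambda>n. h (k n)) \<longlonglongrightarrow> 0" using LIMSEQ_subseq_LIMSEQ[OF _ y(2)] by (simp add: o_def)
    then have h0: "(\<lambda>n. M * h (k n)) \<longlonglongrightarrow> 0" using tendsto_mult_right_zero by blast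
    have "norm (Y (k n) (t - h (k n)) - Y (k n) t) \<le> M * h (k n)" for n
      using Y_lip[of "k n" "t - h (k n)" t] by (simp add: h_def)
    then have "(\<lambda>n. Y (k n) (t - h (k n)) - Y (k n) t) \<longlonglongrightarrow> 0"
      by (intro Lim_null_comparison[OF _ h0]) simp
    from tendsto_add[OF this lim[OF that]] show ?thesis by simp
  qed
  have contG: "isCont G x" for x using cont by (simp add: continuous_on_eq_continuous_at)
  have int_eq: "y t = x0 + integral {0..t} (\<lambda>s. G (y s))" if t: "t \<in> {0..1}" for t
  proof -
    have "(\<lambda>n. integral {0..t} (\<lambda>s. G (Y (k n) (s - h (k n))))) \<longlonglongrightarrow> integral {0..t} (\<lambda>s. G (y s))"
    proof (rule dominated_convergence(2)[where h = "\<lambda>_. M"])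
      show "(\<lambda>s. G (Y (k n) (s - h (k n)))) integrable_on {0..t}" for n
        by (intro integrable_continuous_real continuous_on_compose2[OF cont]
            continuous_on_compose2[OF Y_cont] continuous_intros) auto
      show "(\<lambda>n. G (Y (k n) (s - h (k n)))) \<longlonglongrightarrow> G (y s)" if "s \<in> {0..t}" for s
        using that t by (intro isCont_tendsto_compose[OF contG] lim') auto
    qed (use M in auto)
    from tendsto_add[OF tendsto_const[of x0] this]
    have "(\<lambda>n. Y (k n) t) \<longlonglongrightarrow> x0 + integral {0..t} (\<lambda>s. G (y s))"
      using Y_eq[OF t] by simp
    with lim[OF t] show ?thesis by (rule LIMSEQ_unique)
  qed
  have "solution_on G {0..1} y"
    unfolding solution_on_def
  proof
    fix t :: real assume t: "t \<in> {0..1}"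
    have "continuous_on {0..1} (\<lambda>s. G (y s))" by (rule continuous_on_compose2[OF cont y(1)]) auto
    from integral_has_vector_derivative[OF this t]
    have "((\<lambda>u. x0 + integral {0..u} (\<lambda>s. G (y s))) has_vector_derivative G (y t)) (at t within {0..1})"
      by (auto intro: derivative_eq_intros)
    then show "(y has_vector_derivative G (y t)) (at t within {0..1})"
      by (rule has_vector_derivative_transform[OF t, rotated]) (rule int_eq)
  qed
  moreover have "norm (y t - x0) \<le> M * t" if "t \<in> {0..1}" for t
    by (rule LIMSEQ_le_const2[OF tendsto_norm[OF tendsto_diff[OF lim[OF that] tendsto_const]]])
       (use Y_bound that in auto)
  moreover have "y 0 = x0" using int_eq[of 0] by simp
  ultimately show ?thesis using that by blast
qed

lemma solution_on_subset:
  "solution_on G J x \<Longrightarrow> I \<subseteq> J \<Longrightarrow> solution_on G I x"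
  unfolding solution_on_def by (meson has_vector_derivative_within_subset subsetD)

text \<open>Composing \<open>G\<close> with the closest-point projection onto the unit ball around
  \<open>x0\<close> gives a bounded continuous field. Its solution needs some time to leave the
  ball, and until then the projection acts as the identity.\<close>

lemma peano_existence:
  fixes G :: "'a::euclidean_space \<Rightarrow> 'a"
  assumes cont: "continuous_on UNIV G"
  obtains d y where "d > 0" "y 0 = x0" "solution_on G {0..d} y"
proof -
  define P where "P = closest_point (cball x0 1)"
  have P_in: "P x \<in> cball x0 1" for x
    unfolding P_def by (rule closest_point_in_set) auto
  have P_id: "P x = x" if "x \<in> cball x0 1" for x
    unfolding P_def using that by (rule closest_point_self)
  have cP: "continuous_on UNIV (\<lambda>x. G (P x))"
    unfolding P_def
    by (intro continuous_on_compose2[OF cont] continuous_on_closest_point) auto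
  have "bounded (G ` cball x0 1)"
    by (intro compact_imp_bounded compact_continuous_image continuous_on_subset[OF cont]) auto
  then obtain M where M: "M > 0" "\<And>x. x \<in> cball x0 1 \<Longrightarrow> norm (G x) \<le> M"
    unfolding bounded_pos by auto
  obtain y where y: "y 0 = x0" "solution_on (\<lambda>x. G (P x)) {0..1} y"
      "\<And>t. t \<in> {0..1} \<Longrightarrow> norm (y t - x0) \<le> M * t"
    using peano_bounded[OF cP, of M] M P_in by metis
  \<comment> \<open>The solution moves at most \<open>M * t\<close> away from \<open>x0\<close>, so
    \<open>M * d \<le> 1\<close> keeps it in the ball; the 1 in the minimum is the length of the
    interval it is defined on.\<close>
  define d where "d = min 1 (1 / M)"
  have d: "d > 0" "d \<le> 1" "M * d \<le> 1" using M(1) by (auto simp: d_def min_def field_simps)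
  have "P (y t) = y t" if "t \<in> {0..d}" for t
  proof (rule P_id)
    have "M * t \<le> M * d" using that M(1) by simp
    then show "y t \<in> cball x0 1"
      using y(3)[of t] that d by (auto simp: dist_norm norm_minus_commute)
  qed
  moreover have "solution_on (\<lambda>x. G (P x)) {0..d} y"
    using y(2) by (rule solution_on_subset) (use d in auto)
  ultimately have "solution_on G {0..d} y" unfolding solution_on_def by auto
  then show ?thesis using that d(1) y(1) by blast
qed

section \<open>Gluing, extending and continuing solutions\<close>

lemma solution_on_concat:
  assumes x: "solution_on G {0..b} x" and y: "solution_on G {0..d} y"
    and eq: "y 0 = x b" and "b \<ge> 0" "d \<ge> 0"
  shows "solution_on G {0..b + d} (\<lambda>t. if t \<in> {0..b} then x t else y (t - b))"
  unfolding solution_on_def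
proof
  fix t assume t: "t \<in> {0..b + d}"
  \<comment> \<open>The rule for derivatives of case distinctions adds the intersection of the two
    closures to each piece. Here it is just \<open>{b}\<close>, which both pieces contain.\<close>
  have cl: "{0..b} \<union> (closure {0..b} \<inter> closure {b..b + d}) = {0..b}"
    "{b..b + d} \<union> (closure {0..b} \<inter> closure {b..b + d}) = {b..b + d}"
    using assms(4,5) by auto
  have y': "((\<lambda>t. y (t - b)) has_vector_derivative G (y (t - b))) (at t within {b..b + d})"
    if "t \<in> {b..b + d}"
  proof -
    have im: "(\<lambda>t. t - b) ` {b..b + d} = {0..d}"
      using image_diff_atLeastAtMost[of b b "b+d"] by (simp)
    have "(y has_vector_derivative G (y (t - b))) (at (t - b) within (\<lambda>t. t - b) ` {b..b + d})"
      unfolding im using y that by (auto simp: solution_on_def)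
    moreover have "((\<lambda>t. t - b) has_vector_derivative 1) (at t within {b..b + d})"
      by (auto intro!: derivative_eq_intros)
    ultimately show ?thesis using vector_diff_chain_within by (fastforce simp: o_def)
  qed
  have "((\<lambda>t. if t \<in> {0..b} then x t else y (t - b)) has_vector_derivative
        (if t \<in> {0..b} then G (x t) else G (y (t - b)))) (at t within {0..b + d})"
  proof (rule has_vector_derivative_If_within_closures[where T = "{b..b + d}"], unfold cl)
    show "(x has_vector_derivative G (x t)) (at t within {0..b})" if "t \<in> {0..b}"
      using x that unfolding solution_on_def by blast
    assume "t \<in> closure {0..b}" "t \<in> closure {b..b + d}"
    then have "t = b" by simp
    then show "x t = y (t - b)" "G (x t) = G (y (t - b))" using eq by simp_all
  qed (use t assms(4,5) y' in auto)
  then show "((\<lambda>t. if t \<in> {0..b} then x t else y (t - b)) has_vector_derivative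
        G (if t \<in> {0..b} then x t else y (t - b))) (at t within {0..b + d})"
    by (simp add: if_distrib)
qed

text \<open>\<open>G\<close> is bounded on the compact closure of the orbit, so \<open>x\<close> is
  Lipschitz and extends continuously to \<open>b\<close>. The integral equation survives the passage
  to \<open>b\<close>, and differentiating it yields the one-sided derivative at the
  endpoint.\<close>

lemma solution_on_closed_extension:
  fixes G :: "'a::euclidean_space \<Rightarrow> 'a"
  assumes cont: "continuous_on UNIV G" and "b > 0"
    and x: "solution_on G {0..<b} x" and "bounded (x ` {0..<b})"
  obtains y where "solution_on G {0..b} y" "\<And>t. t \<in> {0..<b} \<Longrightarrow> y t = x t"
proof -
  have "bounded (G ` closure (x ` {0..<b}))"
    using assms(4)
    by (intro compact_imp_bounded compact_continuous_image continuous_on_subset[OF cont]) auto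
  then obtain M where M: "M > 0" "\<And>z. z \<in> closure (x ` {0..<b}) \<Longrightarrow> norm (G z) \<le> M"
    unfolding bounded_pos by auto
  have "M-lipschitz_on {0..<b} x"
  proof (rule bounded_derivative_imp_lipschitz)
    fix t assume t: "t \<in> {0..<b}"
    then show "(x has_derivative (\<lambda>h. h *\<^sub>R G (x t))) (at t within {0..<b})"
      using x unfolding solution_on_def has_vector_derivative_def by blast
    have "x t \<in> closure (x ` {0..<b})" by (rule subsetD[OF closure_subset imageI[OF t]])
    then have "norm (h *\<^sub>R G (x t)) \<le> M * norm h" for h
      using mult_left_mono[OF M(2), of "x t" "\<bar>h\<bar>"] by (simp add: mult.commute)
    then show "onorm (\<lambda>h. h *\<^sub>R G (x t)) \<le> M" by (rule onorm_le)
  qed (use M(1) in auto)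
  then have "uniformly_continuous_on {0..<b} x" by (rule lipschitz_on_uniformly_continuous)
  then obtain y where y: "uniformly_continuous_on (closure {0..<b}) y"
      "\<And>t. t \<in> {0..<b} \<Longrightarrow> x t = y t"
    by (rule uniformly_continuous_on_extension_on_closure) (rule that)
  have cl: "closure {0..<b} = {0..b}" using \<open>b > 0\<close> by simp
  have cy: "continuous_on {0..b} y" using y(1) uniformly_continuous_imp_continuous cl by metis
  then have cGy: "continuous_on {0..b} (\<lambda>t. G (y t))"
    by (rule continuous_on_compose2[OF cont]) auto
  have int: "y t = y 0 + integral {0..t} (\<lambda>s. G (y s))" if "t \<in> {0..<b}" for t
  proof -
    have "{0..t} \<subseteq> {0..<b}" using that by auto
    from solution_on_subset[OF x this]
    have "((\<lambda>s. G (x s)) has_integral (x t - x 0)) {0..t}"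
      using that by (intro fundamental_theorem_of_calculus) (auto simp: solution_on_def)
    then have "integral {0..t} (\<lambda>s. G (x s)) = y t - y 0" using that y(2) by auto
    moreover have "integral {0..t} (\<lambda>s. G (x s)) = integral {0..t} (\<lambda>s. G (y s))"
      using that y(2) by (intro Henstock_Kurzweil_Integration.integral_cong) auto
    ultimately show ?thesis by (simp add: algebra_simps)
  qed
  \<comment> \<open>Both sides are continuous on \<open>{0..b}\<close> and agree on the dense subset
    \<open>{0..<b}\<close>.\<close>
  have int': "y t = y 0 + integral {0..t} (\<lambda>s. G (y s))" if "t \<in> {0..b}" for t
  proof -
    have "y t - (y 0 + integral {0..t} (\<lambda>s. G (y s))) = 0"
    proof (rule continuous_constant_on_closure[of "{0..<b}"
          "\<lambda>t. y t - (y 0 + integral {0..t} (\<lambda>s. G (y s)))"])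
      show "continuous_on (closure {0..<b}) (\<lambda>t. y t - (y 0 + integral {0..t} (\<lambda>s. G (y s))))"
        unfolding cl
        by (intro continuous_intros cy indefinite_integral_continuous_1
            integrable_continuous_real cGy)
      show "y t - (y 0 + integral {0..t} (\<lambda>s. G (y s))) = 0" if "t \<in> {0..<b}" for t
        using int[OF that] by (rule right_minus_eq[THEN iffD2])
    qed (use that cl in blast)
    then show ?thesis by simp
  qed
  have "solution_on G {0..b} y"
    unfolding solution_on_def
  proof
    fix t assume t: "t \<in> {0..b}"
    from integral_has_vector_derivative[OF cGy t]
    have "((\<lambda>u. y 0 + integral {0..u} (\<lambda>s. G (y s))) has_vector_derivative G (y t)) (at t within {0..b})"
      by (auto intro: derivative_eq_intros)
    then show "(y has_vector_derivative G (y t)) (at t within {0..b})"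
      by (rule has_vector_derivative_transform[OF t, rotated]) (rule int')
  qed
  then show ?thesis using that y(2) by simp
qed

text \<open>Otherwise \<open>J\<close> is \<open>{0..b}\<close> or \<open>{0..<b}\<close> with
  \<open>b = Sup J\<close>. The second form is first closed up by continuous extension; then a Peano
  solution started at \<open>y b\<close> continues past \<open>b\<close>, contrary to
  maximality.\<close>

lemma maximal_forward_solution_bounded:
  fixes G :: "'a::euclidean_space \<Rightarrow> 'a"
  assumes cont: "continuous_on UNIV G" and max: "maximal_forward_solution G J x"
    and bd: "bounded (x ` J)"
  shows "J = {0..}"
proof (rule ccontr)
  assume "J \<noteq> {0..}"
  have J: "is_interval J" "0 \<in> J" "J \<subseteq> {0..}" "solution_on G J x"
    using max by (auto simp: maximal_forward_solution_def forward_solution_def)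
  have maxD: "J' = J" if "forward_solution G J' y" "J \<subseteq> J'" "\<And>t. t \<in> J \<Longrightarrow> y t = x t" for J' y
    using max that unfolding maximal_forward_solution_def by blast
  obtain c where c: "c \<ge> 0" "c \<notin> J" using \<open>J \<noteq> {0..}\<close> J(3) by auto
  have below: "t < c" if "t \<in> J" for t
    using c J(1,2) that unfolding is_interval_1 by (meson not_le)
  define b where "b = Sup J"
  have bdd: "bdd_above J" using below by (meson bdd_aboveI less_imp_le)
  have ub: "t \<le> b" if "t \<in> J" for t unfolding b_def using that bdd by (rule cSup_upper)
  have lt: "t \<in> J" if "0 \<le> t" "t < b" for t
  proof -
    obtain u where "u \<in> J" "t < u"
      using less_cSup_iff[OF _ bdd, of t] \<open>t < b\<close> J(2) unfolding b_def by blast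
    then show ?thesis using J(1,2) \<open>0 \<le> t\<close> unfolding is_interval_1 by (meson less_imp_le)
  qed
  have b0: "b \<ge> 0" using ub J(2) by auto
  obtain y where y: "solution_on G {0..b} y" "\<And>t. t \<in> J \<Longrightarrow> y t = x t"
  proof (cases "b \<in> J")
    case True
    then have "t \<in> J \<longleftrightarrow> t \<in> {0..b}" for t using ub[of t] lt[of t] J(3) by (cases "t = b") auto
    then have "J = {0..b}" by blast
    then show ?thesis using that J(4) by blast
  next
    case False
    then have "t \<in> J \<longleftrightarrow> t \<in> {0..<b}" for t using ub[of t] lt[of t] J(3) by (cases "t = b") auto
    then have Jeq: "J = {0..<b}" by blast
    then have "b > 0" using J(2) by auto
    then obtain y where "solution_on G {0..b} y" "\<And>t. t \<in> {0..<b} \<Longrightarrow> y t = x t"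
      using solution_on_closed_extension[OF cont] J(4) bd unfolding Jeq by blast
    then show ?thesis using that Jeq by blast
  qed
  obtain d z where z: "d > 0" "z 0 = y b" "solution_on G {0..d} z"
    using peano_existence[OF cont] by metis
  have "{0..b + d} = J"
  proof (rule maxD)
    show "forward_solution G {0..b + d} (\<lambda>t. if t \<in> {0..b} then y t else z (t - b))"
      using solution_on_concat[OF y(1) z(3,2) b0] z(1) b0
      by (auto simp: forward_solution_def is_interval_1)
    show "J \<subseteq> {0..b + d}"
    proof
      fix t assume "t \<in> J"
      then show "t \<in> {0..b + d}" using ub[of t] z(1) J(3) by auto
    qed
    show "(if t \<in> {0..b} then y t else z (t - b)) = x t" if "t \<in> J" for t
      using that ub[OF that] J(3) y(2)[OF that] by auto
  qed
  then have "b + d \<in> J" using b0 z(1) by auto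
  from ub[OF this] show False using z(1) by simp
qed

section \<open>Gradients, convexity and the Lyapunov property along the homotopy\<close>

lemma smooth_GDERIV:
  assumes "smooth V"
  shows "GDERIV V x :> gradient V x"
proof -
  have "Ck (Suc 0) V" using assms unfolding smooth_def by blast
  then show ?thesis
    by (intro GDERIV_gradient) (auto simp: differentiable_on_eq_differentiable_at)
qed

lemma smooth_continuous_on:
  assumes "smooth V"
  shows "continuous_on A V"
proof -
  have "Ck 0 V" using assms unfolding smooth_def by blast
  then show ?thesis using continuous_on_subset by auto
qed

text \<open>\<open>Ck\<close> speaks of directional derivatives only. These are inner products with
  the gradient, so basis directions give its components.\<close>

lemma continuous_on_gradient:
  assumes "smooth V"
  shows "continuous_on UNIV (gradient V)"
proof -
  have "Ck (Suc 0) V" using assms unfolding smooth_def by blast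
  then have "continuous_on UNIV (\<lambda>x. frechet_derivative V (at x) v)" for v by simp
  moreover have "frechet_derivative V (at x) v = gradient V x \<bullet> v" for x v
    using smooth_GDERIV[OF assms, of x] unfolding gderiv_def
    by (metis frechet_derivative_at inner_commute)
  ultimately show ?thesis
    by (subst continuous_on_componentwise) auto
qed

text \<open>Along the line through 0 and \<open>x\<close>, \<open>V\<close> is a convex function of
  one variable and lies above its tangent at parameter 1. Evaluating that tangent at parameter 0
  gives the inequality.\<close>

lemma convex_gradient_inner_ge:
  assumes "smooth V" "convex_on UNIV V"
  shows "gradient V x \<bullet> x \<ge> V x - V 0"
proof -
  have "((\<lambda>t. t *\<^sub>R x) has_derivative (\<lambda>h. h *\<^sub>R x)) (at 1)"
    by (auto intro!: derivative_eq_intros)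
  moreover have "(V has_derivative (\<lambda>h. h \<bullet> gradient V x)) (at (1 *\<^sub>R x))"
    using smooth_GDERIV[OF assms(1), of x] by (simp add: gderiv_def)
  ultimately have "((\<lambda>t. V (t *\<^sub>R x)) has_derivative (\<lambda>h. (h *\<^sub>R x) \<bullet> gradient V x)) (at 1)"
    using has_derivative_compose by blast
  then have deriv: "((\<lambda>t. V (t *\<^sub>R x)) has_field_derivative (gradient V x \<bullet> x)) (at (1::real))"
    by (simp add: has_field_derivative_def inner_commute[of x] mult_commute_abs)
  have "convex_on UNIV (\<lambda>t. V (t *\<^sub>R x))"
  proof (rule convex_onI)
    fix t a b :: real assume "0 < t" "t < 1"
    then show "V (((1 - t) *\<^sub>R a + t *\<^sub>R b) *\<^sub>R x) \<le> (1 - t) * V (a *\<^sub>R x) + t * V (b *\<^sub>R x)"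
      using convex_onD[OF assms(2), of t "a *\<^sub>R x" "b *\<^sub>R x"] by (simp add: scaleR_left_distrib)
  qed auto
  from convex_on_imp_above_tangent[OF this _ _ _ deriv, of 0]
  show ?thesis by simp
qed

lemma lyapunov_function_homotopy:
  assumes V: "lyapunov_function F V" "convex_on UNIV V" and s: "s \<in> {0..1}"
  shows "lyapunov_function (straight_line_homotopy F (\<lambda>x. - x) s) V"
proof -
  have "gradient V x \<bullet> straight_line_homotopy F (\<lambda>x. - x) s x < 0" if "x \<noteq> 0" for x
  proof -
    have F: "gradient V x \<bullet> F x < 0" using V(1) that by (simp add: lyapunov_function_def)
    have "gradient V x \<bullet> x \<ge> V x - V 0"
      using V by (intro convex_gradient_inner_ge) (auto simp: lyapunov_function_def)
    then have x: "gradient V x \<bullet> x > 0"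
      using V(1) that unfolding lyapunov_function_def by (smt (verit))
    have "(1 - s) * (gradient V x \<bullet> F x) - s * (gradient V x \<bullet> x) < 0"
    \<comment> \<open>Strictness changes its source: for positive \<open>s\<close> it comes from the
      \<open>- x\<close> term, since the \<open>F\<close> term vanishes at \<open>s = 1\<close>; for
      \<open>s = 0\<close> it comes from \<open>F\<close>.\<close>
    proof (cases "s = 0")
      case False
      then have "s * (gradient V x \<bullet> x) > 0" using s x by simp
      moreover have "(1 - s) * (gradient V x \<bullet> F x) \<le> 0"
        using s F by (intro mult_nonneg_nonpos) auto
      ultimately show ?thesis by linarith
    qed (use F in simp)
    then show ?thesis by (simp add: straight_line_homotopy_def inner_diff_right)
  qed
  then show ?thesis using V(1) by (simp add: lyapunov_function_def)
qed

section \<open>Proper functions and their decrease along solutions\<close>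

text \<open>Used in contrapositive form: a small value of \<open>V\<close> forces a small norm.
  \<open>V\<close> has a positive minimum on the compact shell between radii \<open>e\<close> and
  \<open>R\<close>, and properness takes care of everything outside.\<close>

lemma proper_positive_away:
  fixes V :: "'a::euclidean_space \<Rightarrow> real"
  assumes cont: "continuous_on UNIV V" and lim: "filterlim V at_top at_infinity"
    and pos: "\<And>x. x \<noteq> 0 \<Longrightarrow> V x > 0" and "e > 0"
  obtains m where "m > 0" "\<And>x. norm x \<ge> e \<Longrightarrow> V x \<ge> m"
proof -
  obtain R where R: "\<And>x. norm x \<ge> R \<Longrightarrow> V x \<ge> 1"
    using lim unfolding filterlim_at_top eventually_at_infinity by blast
  define K where "K = cball 0 R - ball (0::'a) e"
  show ?thesis
  proof (cases "K = {}")
    case True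
    have "V x \<ge> 1" if "norm x \<ge> e" for x
    proof (rule R, rule ccontr)
      assume "\<not> R \<le> norm x"
      then have "x \<in> K" using that by (auto simp: K_def)
      then show False using True by blast
    qed
    then show ?thesis using that[of 1] by simp
  next
    case False
    have "compact K" unfolding K_def by (intro compact_diff) auto
    then obtain z where z: "z \<in> K" "\<And>x. x \<in> K \<Longrightarrow> V z \<le> V x"
      using continuous_attains_inf[OF _ False continuous_on_subset[OF cont]] by blast
    have "z \<noteq> 0" using z(1) \<open>e > 0\<close> by (auto simp: K_def)
    then have "V z > 0" by (rule pos)
    moreover have "V x \<ge> min 1 (V z)" if "norm x \<ge> e" for x
      using R[of x] z(2)[of x] that by (cases "norm x \<ge> R") (auto simp: K_def)
    ultimately show ?thesis using that[of "min 1 (V z)"] by simp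
  qed
qed

lemma proper_bounded_sublevel:
  fixes V :: "'a::euclidean_space \<Rightarrow> real"
  assumes "filterlim V at_top at_infinity"
  shows "bounded {x. V x \<le> c}"
proof -
  obtain R where R: "\<And>x. norm x \<ge> R \<Longrightarrow> V x \<ge> c + 1"
    using assms unfolding filterlim_at_top eventually_at_infinity by blast
  have "norm x \<le> R" if "V x \<le> c" for x using R[of x] that by linarith
  then show ?thesis unfolding bounded_iff by blast
qed

text \<open>Mean value theorem for \<open>V\<close> along \<open>x\<close>. With
  \<open>m = 0\<close> it yields monotonicity, with positive \<open>m\<close> a linear rate of
  descent.\<close>

lemma decrease_along_solution:
  assumes V: "smooth V" and x: "solution_on G J x" and "{s..t} \<subseteq> J" "s \<le> t"
    and d: "\<And>u. u \<in> {s..t} \<Longrightarrow> gradient V (x u) \<bullet> G (x u) \<le> - m"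
  shows "V (x t) \<le> V (x s) - m * (t - s)"
proof -
  have "\<exists>u\<in>{s..t}. V (x t) - V (x s) = (\<lambda>h. (h *\<^sub>R G (x u)) \<bullet> gradient V (x u)) (t - s)"
  proof (rule mvt_very_simple[OF \<open>s \<le> t\<close>])
    fix u assume u: "s \<le> u" "u \<le> t"
    have "(x has_derivative (\<lambda>h. h *\<^sub>R G (x u))) (at u within {s..t})"
      using solution_on_subset[OF x \<open>{s..t} \<subseteq> J\<close>] u
      by (auto simp: solution_on_def has_vector_derivative_def)
    then show "((\<lambda>t. V (x t)) has_derivative (\<lambda>h. (h *\<^sub>R G (x u)) \<bullet> gradient V (x u))) (at u within {s..t})"
      using smooth_GDERIV[OF V, of "x u"] has_derivative_compose unfolding gderiv_def by blast
  qed
  then obtain u where u: "u \<in> {s..t}" "V (x t) - V (x s) = (t - s) * (gradient V (x u) \<bullet> G (x u))"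
    by (auto simp: inner_commute)
  moreover have "(t - s) * (gradient V (x u) \<bullet> G (x u)) \<le> (t - s) * (- m)"
    using d[OF u(1)] \<open>s \<le> t\<close> by (intro mult_left_mono) auto
  ultimately show ?thesis by (simp add: algebra_simps)
qed

section \<open>Lyapunov's direct method for a continuous field\<close>

locale lyapunov_field =
  fixes G :: "'a::euclidean_space \<Rightarrow> 'a" and V :: "'a \<Rightarrow> real"
  assumes contG: "continuous_on UNIV G" and G0: "G 0 = 0" and V: "lyapunov_function G V"
begin

lemma smoothV: "smooth V" and V_0: "V 0 = 0" and V_nonneg: "V x \<ge> 0"
  and V_pos: "x \<noteq> 0 \<Longrightarrow> V x > 0" and grad_neg: "x \<noteq> 0 \<Longrightarrow> gradient V x \<bullet> G x < 0"
  and V_proper: "filterlim V at_top at_infinity"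
  using V by (auto simp: lyapunov_function_def)

lemma contV: "continuous_on UNIV V"
  using smoothV by (rule smooth_continuous_on)

lemma V_antimono:
  assumes "forward_solution G J x" "s \<in> J" "t \<in> J" "s \<le> t"
  shows "V (x t) \<le> V (x s)"
proof -
  have J: "is_interval J" "solution_on G J x" using assms(1) by (auto simp: forward_solution_def)
  have "{s..t} \<subseteq> J"
  proof
    fix u assume "u \<in> {s..t}"
    then show "u \<in> J" using mem_is_interval_1_I[OF J(1) assms(2,3), of u] by simp
  qed
  \<comment> \<open>Written \<open>- 0\<close> to match the rate \<open>- m\<close> with
    \<open>m = 0\<close>. At the origin the field vanishes.\<close>
  moreover have "gradient V y \<bullet> G y \<le> - 0" for y
    using grad_neg[of y] G0 by (cases "y = 0") auto
  ultimately have "V (x t) \<le> V (x s) - 0 * (t - s)"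
    by (intro decrease_along_solution[OF smoothV J(2) _ assms(4)])
  then show ?thesis by simp
qed

text \<open>An open sublevel set of \<open>V\<close> small enough to fit into \<open>U\<close>
  serves as \<open>W\<close>; it is forward invariant because \<open>V\<close> does not increase
  along solutions.\<close>

lemma lyapunov_stable: "lyapunov_stable G"
  unfolding lyapunov_stable_def
proof (intro allI impI)
  fix U :: "'a set" assume U: "open U \<and> 0 \<in> U"
  then obtain e where e: "e > 0" "ball 0 e \<subseteq> U" using open_contains_ball by blast
  obtain m where m: "m > 0" "\<And>x. norm x \<ge> e \<Longrightarrow> V x \<ge> m"
    using proper_positive_away[OF contV V_proper V_pos e(1)] by blast
  have sub: "{x. V x < m} \<subseteq> U"
  proof
    fix x assume "x \<in> {x. V x < m}"
    then have "norm x < e" using m(2)[of x] by fastforce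
    then show "x \<in> U" using e(2) by auto
  qed
  show "\<exists>W. open W \<and> 0 \<in> W \<and> W \<subseteq> U \<and>
      (\<forall>J x. forward_solution G J x \<and> x 0 \<in> W \<longrightarrow> (\<forall>t\<in>J. x t \<in> U))"
  proof (intro exI[of _ "{x. V x < m}"] conjI allI impI ballI)
    show "open {x. V x < m}"
      by (intro open_Collect_less contV continuous_on_const)
    fix J x t assume J: "forward_solution G J x \<and> x 0 \<in> {x. V x < m}" and t: "t \<in> J"
    then have "0 \<in> J" "0 \<le> t" by (auto simp: forward_solution_def)
    then have "V (x t) \<le> V (x 0)" using V_antimono J t by blast
    then show "x t \<in> U" using sub J by auto
  qed (use m(1) V_0 sub in auto)
qed

text \<open>If \<open>V\<close> never dropped below \<open>m\<close>, the orbit would stay in a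
  compact set avoiding 0. There the derivative of \<open>V\<close> along \<open>G\<close> is at most
  some \<open>- c < 0\<close>, so \<open>V\<close> would become negative in finite time.\<close>

lemma V_eventually_less:
  assumes x: "forward_solution G {0..} x" and "m > 0"
  shows "\<exists>T\<ge>0. \<forall>t\<ge>T. V (x t) < m"
proof (rule ccontr)
  assume contra: "\<not> ?thesis"
  have ge: "V (x t) \<ge> m" if "t \<ge> 0" for t
  proof (rule ccontr)
    assume "\<not> V (x t) \<ge> m"
    then have "V (x u) < m" if "u \<ge> t" for u
      using V_antimono[OF x, of t u] that \<open>t \<ge> 0\<close> by simp
    then have "\<exists>T\<ge>0. \<forall>u\<ge>T. V (x u) < m" using \<open>t \<ge> 0\<close> by (intro exI[of _ t]) simp
    with contra show False ..
  qed
  define K where "K = {y. V y \<le> V (x 0)} \<inter> {y. m \<le> V y}"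
  have xK: "x t \<in> K" if "t \<ge> 0" for t
    using that ge[OF that] V_antimono[OF x, of 0 t] by (simp add: K_def)
  have "closed K"
    unfolding K_def by (intro closed_Int closed_Collect_le contV continuous_on_const)
  moreover have "bounded K"
    unfolding K_def by (intro bounded_Int disjI1 proper_bounded_sublevel V_proper)
  ultimately have "compact K" using compact_eq_bounded_closed by blast
  moreover have "continuous_on K (\<lambda>y. gradient V y \<bullet> G y)"
    by (intro continuous_on_inner continuous_on_subset[OF contG]
        continuous_on_subset[OF continuous_on_gradient[OF smoothV]]) auto
  moreover have "K \<noteq> {}" using xK[of 0] by auto
  ultimately obtain z where z: "z \<in> K" "\<And>y. y \<in> K \<Longrightarrow> gradient V y \<bullet> G y \<le> gradient V z \<bullet> G z"
    using continuous_attains_sup[of K "\<lambda>y. gradient V y \<bullet> G y"] by auto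
  define c where "c = - (gradient V z \<bullet> G z)"
  have "z \<noteq> 0" using z(1) V_0 \<open>m > 0\<close> by (auto simp: K_def)
  then have c: "c > 0" using grad_neg by (simp add: c_def)
  \<comment> \<open>Chosen so that \<open>V (x 0) - c * T = - 1\<close>.\<close>
  define T where "T = (V (x 0) + 1) / c"
  have T: "T \<ge> 0" using V_nonneg[of "x 0"] c by (simp add: T_def)
  have "V (x T) \<le> V (x 0) - c * (T - 0)"
  proof (rule decrease_along_solution[OF smoothV _ _ T])
    show "solution_on G {0..} x" using x by (simp add: forward_solution_def)
    fix u assume "u \<in> {0..T}"
    then have "x u \<in> K" using xK by simp
    from z(2)[OF this] show "gradient V (x u) \<bullet> G (x u) \<le> - c" by (simp add: c_def)
  qed auto
  also have "\<dots> = - 1" using c by (simp add: T_def)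
  finally show False using V_nonneg[of "x T"] by linarith
qed

text \<open>The orbit stays in the bounded sublevel set of its starting value, so a maximal solution
  lives on all of \<open>{0..}\<close>. Then \<open>V\<close> becomes arbitrarily small along it,
  and hence so does the norm.\<close>

lemma globally_attractive: "globally_attractive G"
  unfolding globally_attractive_def
proof (intro allI impI)
  fix x0 J x assume "maximal_forward_solution G J x \<and> x 0 = x0"
  then have max: "maximal_forward_solution G J x" by blast
  then have fwd: "forward_solution G J x" by (simp add: maximal_forward_solution_def)
  have "x ` J \<subseteq> {y. V y \<le> V (x 0)}"
    using V_antimono[OF fwd, of 0] fwd by (auto simp: forward_solution_def)
  then have "bounded (x ` J)"
    using proper_bounded_sublevel[OF V_proper] bounded_subset by blast
  then have J: "J = {0..}" by (rule maximal_forward_solution_bounded[OF contG max])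
  have "(x \<longlongrightarrow> 0) at_top"
  proof (rule tendstoI)
    fix e :: real assume "e > 0"
    then obtain m where m: "m > 0" "\<And>x. norm x \<ge> e \<Longrightarrow> V x \<ge> m"
      using proper_positive_away[OF contV V_proper V_pos] by blast
    obtain T where "\<And>t. t \<ge> T \<Longrightarrow> V (x t) < m"
      using V_eventually_less[OF _ m(1)] fwd J by blast
    have "dist (x t) 0 < e" if "t \<ge> T" for t
      using m(2)[of "x t"] \<open>\<And>t. t \<ge> T \<Longrightarrow> V (x t) < m\<close>[OF that] by (cases "norm (x t) < e") auto
    then show "\<forall>\<^sub>F t in at_top. dist (x t) 0 < e"
      unfolding eventually_at_top_linorder by blast
  qed
  with J show "J = {0..} \<and> (x \<longlongrightarrow> 0) at_top" by blast
qed

lemma GAS: "GAS G"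
  using contG G0 lyapunov_stable globally_attractive by (simp add: GAS_def)

end

theorem mainTheorem1:
  fixes F :: "real ^ 'n \<Rightarrow> real ^ 'n"
  assumes "continuous_on UNIV F"
    and "complete_vector_field F"
    and "GAS F"
    and "\<exists>V. lyapunov_function F V \<and> convex_on UNIV V"
  shows "continuous_on ({0..1} \<times> UNIV) (\<lambda>(s, x). straight_line_homotopy F (\<lambda>x. - x) s x) \<and>
         straight_line_homotopy F (\<lambda>x. - x) 0 = F \<and>
         straight_line_homotopy F (\<lambda>x. - x) 1 = (\<lambda>x. - x) \<and>
         (\<forall>s\<in>{0..1}. GAS (straight_line_homotopy F (\<lambda>x. - x) s))"
proof (intro conjI ballI)
  show "continuous_on ({0..1} \<times> UNIV) (\<lambda>(s, x). straight_line_homotopy F (\<lambda>x. - x) s x)"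
    unfolding straight_line_homotopy_def case_prod_unfold
    by (intro continuous_intros continuous_on_compose2[OF assms(1)]) auto
  show "straight_line_homotopy F (\<lambda>x. - x) 0 = F"
    "straight_line_homotopy F (\<lambda>x. - x) 1 = (\<lambda>x. - x)"
    by (auto simp: straight_line_homotopy_def)
  fix s :: real assume s: "s \<in> {0..1}"
  obtain V where V: "lyapunov_function F V" "convex_on UNIV V" using assms(4) by blast
  have "F 0 = 0" using assms(3) by (simp add: GAS_def)
  \<comment> \<open>One \<open>V\<close> serves all \<open>s\<close>, and \<open>F 0 = 0\<close>
    makes 0 an equilibrium of every intermediate field.\<close>
  then have "lyapunov_field (straight_line_homotopy F (\<lambda>x. - x) s) V"
    using lyapunov_function_homotopy[OF V s]
    by unfold_locales
       (auto simp: straight_line_homotopy_def intro!: continuous_intros assms(1))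
  then show "GAS (straight_line_homotopy F (\<lambda>x. - x) s)"
    by (rule lyapunov_field.GAS)
qed

end
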